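(* Let $A^i\in\mathbb{C}^{n_{2i-1}\times n_{2i}}$, $i=1,\dots,d$, be matrices, and let $\mathcal{F}\in\mathbb{C}^{n_1\times n_2\times\cdots\times n_{2d}}$ be the even-order tensor $$\mathcal{F}=A^1\otimes A^2\otimes\cdots\otimes A^d.$$ Denote $r_i=\operatorname{rank}(A^i)$ for $i=1,\dots,d$. Then $$\operatorname{rank}_{CP}(\mathcal{F})=\operatorname{rank}_{M^+}(\mathcal{F})=r_1r_2\cdots r_d.$$
   Context: $\otimes$ is the outer product of tensors: $(\mathcal{A}\otimes\mathcal{B})_{i_1\cdots i_{k+\ell}}=\mathcal{A}_{i_1\cdots i_k}\mathcal{B}_{i_{k+1}\cdots i_{k+\ell}}$. The CP-rank $\operatorname{rank}_{CP}(\mathcal{F})$ of a $p$-th order tensor $\mathcal{F}\in\mathbb{C}^{n_1\times\cdots\times n_p}$ is the smallest integer $r$ such that $\mathcal{F}=\sum_{i=1}^r a^{1,i}\otimes\cdots\otimes a^{p,i}$ with $a^{k,i}\in\mathbb{C}^{n_k}$. The square unfolding of $\mathcal{G}\in\mathbb{C}^{m_1\times\cdots\times m_{2d}}$ is the matrix $\boldsymbol{M}(\mathcal{G})\in\mathbb{C}^{(m_1\cdots m_d)\times(m_{d+1}\cdots m_{2d})}$ whose rows are indexed by $(i_1,\dots,i_d)$, whose columns are indexed by $(i_{d+1},\dots,i_{2d})$, with corresponding entry $\mathcal{G}_{i_1\cdots i_{2d}}$. For a permutation $\pi$ of $(1,\dots,2d)$, $\mathcal{F}_\pi$ is the tensor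 obtained by permuting the indices of $\mathcal{F}$ according to $\pi$. The M$^+$-rank is $\operatorname{rank}_{M^+}(\mathcal{F})=\max_\pi\operatorname{rank}(\boldsymbol{M}(\mathcal{F}_\pi))$, the maximum over all permutations $\pi$ of $(1,\dots,2d)$. *)

theory Defs
  imports Complex_Main "HOL-Library.FuncSet" "HOL-Combinatorics.Permutations"
    "Jordan_Normal_Form.DL_Rank"
begin

definition multi_indices :: "nat list \<Rightarrow> nat list set" where
  "multi_indices ns = {is. length is = length ns \<and> (\<forall>k<length ns. is ! k < ns ! k)}"

text \<open>A tensor is a list of dimensions together with its entries, indexed by multi-indices
  (lists of 0-based indices). The entry function is extensional, so that two tensors are equal
  iff they have the same dimensions and the same entries at all valid multi-indices.\<close>

typedef 'a tensor = "{(ns, f :: nat list \<Rightarrow> 'a). f \<in> extensional (multi_indices ns)}"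
  by (rule exI[of _ "([], \<lambda>_. undefined)"]) (simp add: extensional_def)

definition dims :: "'a tensor \<Rightarrow> nat list" where
  "dims T = fst (Rep_tensor T)"

definition entry :: "'a tensor \<Rightarrow> nat list \<Rightarrow> 'a" where
  "entry T = snd (Rep_tensor T)"

definition mk_tensor :: "nat list \<Rightarrow> (nat list \<Rightarrow> 'a) \<Rightarrow> 'a tensor" where
  "mk_tensor ns f = Abs_tensor (ns, restrict f (multi_indices ns))"

lemma dims_mk_tensor [simp]: "dims (mk_tensor ns f) = ns"
  by (simp add: dims_def mk_tensor_def Abs_tensor_inverse)

lemma entry_mk_tensor [simp]:
  "is \<in> multi_indices ns \<Longrightarrow> entry (mk_tensor ns f) is = f is"
  by (simp add: entry_def mk_tensor_def Abs_tensor_inverse)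

lemma tensor_eqI:
  assumes "dims S = dims T"
    and "\<And>is. is \<in> multi_indices (dims T) \<Longrightarrow> entry S is = entry T is"
  shows "S = T"
proof -
  have "entry S \<in> extensional (multi_indices (dims T))" 
    "entry T \<in> extensional (multi_indices (dims T))"
    using Rep_tensor[of S] Rep_tensor[of T] assms(1)
    by (auto simp: dims_def entry_def)
  then have "entry S = entry T"
    using assms(2) by (rule extensionalityI)
  with assms(1) show ?thesis
    by (metis Rep_tensor_inject dims_def entry_def prod.expand)
qed

definition tensor_of_vec :: "'a vec \<Rightarrow> 'a tensor" where
  "tensor_of_vec v = mk_tensor [dim_vec v] (\<lambda>is. v $ (is ! 0))"

definition tensor_of_mat :: "'a mat \<Rightarrow> 'a tensor" where
  "tensor_of_mat A = mk_tensor [dim_row A, dim_col A] (\<lambda>is. A $$ (is ! 0, is ! 1))"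

definition tensor_outer :: "'a::times tensor \<Rightarrow> 'a tensor \<Rightarrow> 'a tensor" (infixr "\<otimes>\<^sub>T" 70) where
  "S \<otimes>\<^sub>T T = mk_tensor (dims S @ dims T)
     (\<lambda>is. entry S (take (length (dims S)) is) * entry T (drop (length (dims S)) is))"

text \<open>The iterated outer product; the order-0 tensor 1 is neutral for the outer product
  (the next two lemmas).\<close>

definition tensor_outer_list :: "'a::comm_semiring_1 tensor list \<Rightarrow> 'a tensor" where
  "tensor_outer_list Ts = foldr (\<otimes>\<^sub>T) Ts (mk_tensor [] (\<lambda>_. 1))"

lemma tensor_outer_one_right: "T \<otimes>\<^sub>T mk_tensor [] (\<lambda>_. 1 :: 'a::comm_semiring_1) = T"
  by (rule tensor_eqI) (auto simp: tensor_outer_def multi_indices_def)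

lemma tensor_outer_one_left: "mk_tensor [] (\<lambda>_. 1 :: 'a::comm_semiring_1) \<otimes>\<^sub>T T = T"
  by (rule tensor_eqI) (auto simp: tensor_outer_def multi_indices_def)

text \<open>The dimensions are an argument so that the empty sum is the zero tensor of that shape.\<close>

definition tensor_sum :: "nat list \<Rightarrow> nat \<Rightarrow> (nat \<Rightarrow> 'a::comm_monoid_add tensor) \<Rightarrow> 'a tensor" where
  "tensor_sum ns r T = mk_tensor ns (\<lambda>is. \<Sum>i<r. entry (T i) is)"

definition cp_rank :: "complex tensor \<Rightarrow> nat" where
  "cp_rank F = (LEAST r. \<exists>a :: nat \<Rightarrow> nat \<Rightarrow> complex vec.
     (\<forall>i<r. \<forall>k<length (dims F). a k i \<in> carrier_vec (dims F ! k)) \<and>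
     F = tensor_sum (dims F) r
           (\<lambda>i. tensor_outer_list (map (\<lambda>k. tensor_of_vec (a k i)) [0..<length (dims F)])))"

text \<open>The multi-indices in lexicographic order, used to number rows and columns of the unfolding.\<close>

definition multi_index_list :: "nat list \<Rightarrow> nat list list" where
  "multi_index_list ns = product_lists (map (\<lambda>n. [0..<n]) ns)"

lemma set_multi_index_list: "set (multi_index_list ns) = multi_indices ns"
  by (auto simp: multi_index_list_def product_lists_set multi_indices_def list_all2_conv_all_nth)

lemma length_multi_index_list: "length (multi_index_list ns) = prod_list ns"
proof (induction ns)
  case (Cons n ns)
  have "length (concat (map (\<lambda>x. map ((#) x) L) [0..<n])) = n * length L" for L :: "nat list list"
    by (induction n) auto
  with Cons show ?case by (simp add: multi_index_list_def)
qed (simp add: multi_index_list_def)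

lemma distinct_multi_index_list: "distinct (multi_index_list ns)"
proof -
  have "card (multi_indices ns) = prod_list ns"
  proof (induction ns)
    case Nil
    then show ?case by (simp add: multi_indices_def)
  next
    case (Cons n ns)
    have "multi_indices (n # ns) = (\<lambda>(x, xs). x # xs) ` ({..<n} \<times> multi_indices ns)"
      by (auto simp: multi_indices_def image_iff length_Suc_conv All_less_Suc2)
    then show ?case
      using Cons by (simp add: card_image inj_on_def card_cartesian_product)
  qed
  then show ?thesis
    by (simp add: card_distinct set_multi_index_list length_multi_index_list)
qed

definition square_unfolding :: "'a tensor \<Rightarrow> 'a mat" where
  "square_unfolding G = (let d = length (dims G) div 2;
       rows = take d (dims G); cols = drop d (dims G)
     in mat (prod_list rows) (prod_list cols)
          (\<lambda>(i, j). entry G (multi_index_list rows ! i @ multi_index_list cols ! j)))"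

text \<open>The dimensions of the permuted tensor are \<open>n\<^bsub>\<pi> 0\<^esub>, n\<^bsub>\<pi> 1\<^esub>, \<dots>\<close>, and its entry at
  \<open>(i\<^bsub>\<pi> 0\<^esub>, i\<^bsub>\<pi> 1\<^esub>, \<dots>)\<close> is the entry of \<open>F\<close> at \<open>(i\<^bsub>0\<^esub>, i\<^bsub>1\<^esub>, \<dots>)\<close>.\<close>

definition permute_tensor :: "(nat \<Rightarrow> nat) \<Rightarrow> 'a tensor \<Rightarrow> 'a tensor" where
  "permute_tensor \<pi> F = mk_tensor (permute_list \<pi> (dims F))
     (\<lambda>is. entry F (permute_list (Hilbert_Choice.inv \<pi>) is))"

lemma entry_permute_tensor:
  assumes "\<pi> permutes {..<length (dims F)}" "is \<in> multi_indices (dims F)"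
  shows "entry (permute_tensor \<pi> F) (permute_list \<pi> is) = entry F is"
proof -
  from assms have l: "length is = length (dims F)" 
    by (simp add: multi_indices_def)
  have "permute_list \<pi> is \<in> multi_indices (permute_list \<pi> (dims F))"
    using assms permutes_in_image[OF assms(1)]
    by (auto simp: multi_indices_def permute_list_nth)
  moreover have "permute_list (Hilbert_Choice.inv \<pi>) (permute_list \<pi> is) = is"
    using assms(1) l
    by (metis permute_list_compose permute_list_id permutes_inv permutes_inv_o(1))
  ultimately show ?thesis
    by (simp add: permute_tensor_def)
qed

definition mat_rank :: "'a::field mat \<Rightarrow> nat" where
  "mat_rank A = vec_space.rank (dim_row A) A"

definition mplus_rank :: "complex tensor \<Rightarrow> nat" where
  "mplus_rank F = Max {mat_rank (square_unfolding (permute_tensor \<pi> F)) | \<pi>.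
     \<pi> permutes {..<length (dims F)}}"

end

theory Submission
  imports Defs
begin

text \<open>The chain \<open>r\<^sub>1 \<cdots> r\<^sub>d \<le> rank\<^bsub>M\<^sup>+\<^esub> \<le> rank\<^bsub>CP\<^esub> \<le> r\<^sub>1 \<cdots> r\<^sub>d\<close> is proved.

  The last inequality: writing each matrix as a sum of \<open>r\<^sub>i\<close> dyads and expanding the product
  of the sums gives a CP decomposition with \<open>r\<^sub>1 \<cdots> r\<^sub>d\<close> terms
  (\<open>cp_rank_at_most_mat_product\<close>).  The middle one: permuting the indices of a rank-one tensor
  gives a rank-one tensor, and its unfolding is a dyad, so a CP decomposition with \<open>r\<close> terms
  turns into a sum of \<open>r\<close> dyads for every unfolding (\<open>cp_rank_at_most_permute_tensor\<close>,
  \<open>mat_rank_square_unfolding_le\<close>).  The first one: the permutation that puts the row indices of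
  all matrices first and their column indices last turns the unfolding into the Kronecker
  product of the matrices, whose rank is at least \<open>r\<^sub>1 \<cdots> r\<^sub>d\<close>
  (\<open>mat_rank_deinterleaved_ge\<close>).

  Two certificates make all three steps elementary.  An upper bound \<open>s\<close> on the rank of \<open>f\<close> is
  certified by a factorization \<open>f = U V\<close> with inner dimension \<open>s\<close>, a lower bound \<open>|K|\<close> by
  matrices with \<open>L f R = 1\<^sub>K\<close>.  Gaussian elimination yields both certificates with the same value
  (\<open>rank_bounds_meet\<close>), the first one describes the dimension of the column space
  (\<open>mat_rank_le_iff\<close>), and the second one is multiplicative under Kronecker products simply
  because a product of identities is an identity (\<open>rank_at_least_kronecker\<close>).\<close>

section \<open>Certificates for the rank of a matrix\<close>

text \<open>Matrices are functions on arbitrary index sets here, since rows and columns of an unfolding are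
  indexed by multi-indices.\<close>

definition rank_at_most :: "('i \<Rightarrow> 'j \<Rightarrow> 'a::field) \<Rightarrow> 'i set \<Rightarrow> 'j set \<Rightarrow> nat \<Rightarrow> bool" where
  "rank_at_most f I J s \<longleftrightarrow> (\<exists>u v. \<forall>i\<in>I. \<forall>j\<in>J. f i j = (\<Sum>k<s. u k i * v k j))"

text \<open>The condition \<open>L f R = 1\<^sub>K\<close> of a lower certificate. The index set \<open>K\<close> is kept, and not only its
  size, so that for a Kronecker product it can again be a set of multi-indices.\<close>

definition rank_at_least :: "('i \<Rightarrow> 'j \<Rightarrow> 'a::field) \<Rightarrow> 'i set \<Rightarrow> 'j set \<Rightarrow> 'k set \<Rightarrow> bool" where
  "rank_at_least f I J K \<longleftrightarrow> (\<exists>L R. \<forall>a\<in>K. \<forall>b\<in>K.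
     (\<Sum>j\<in>J. (\<Sum>i\<in>I. L a i * f i j) * R b j) = (if a = b then 1 else 0))"

text \<open>If \<open>s < N\<close>, then padding \<open>x\<close> and \<open>y\<close> with zeros to square matrices gives a singular factor of
  the identity.\<close>

lemma identity_needs_dyads:
  fixes x y :: "nat \<Rightarrow> nat \<Rightarrow> 'a::field"
  assumes "\<And>a b. a < N \<Longrightarrow> b < N \<Longrightarrow> (\<Sum>k<s. x a k * y k b) = (if a = b then 1 else 0)"
  shows "N \<le> s"
proof (rule ccontr)
  assume "\<not> N \<le> s"
  then have sN: "s < N" by simp
  define P where "P = mat N N (\<lambda>(a, k). if k < s then x a k else 0)"
  define Q where "Q = mat N N (\<lambda>(k, b). if k < s then y k b else 0)"
  have P: "P \<in> carrier_mat N N" and Q: "Q \<in> carrier_mat N N"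
    by (simp_all add: P_def Q_def)
  have "P * Q = 1\<^sub>m N"
  proof (rule eq_matI)
    fix a b assume "a < dim_row (1\<^sub>m N)" "b < dim_col (1\<^sub>m N)"
    then have ab: "a < N" "b < N" by auto
    have "(P * Q) $$ (a, b) = (\<Sum>k\<in>{0..<N}. if k < s then x a k * y k b else 0)"
      using ab by (auto simp: P_def Q_def scalar_prod_def intro!: sum.cong)
    also have "\<dots> = (\<Sum>k<s. x a k * y k b)"
      using sN by (intro sum.mono_neutral_cong_right) auto
    finally show "(P * Q) $$ (a, b) = 1\<^sub>m N $$ (a, b)"
      using assms ab by simp
  qed (auto simp: P_def Q_def)
  then have "det P * det Q = 1"
    using det_mult[OF P Q] by simp
  moreover have "P *\<^sub>v unit_vec N s = 0\<^sub>v N"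
    using sN by (auto simp: P_def)
  then have "det P = 0"
    using det_0_iff_vec_prod_zero[OF P] sN
    by (metis unit_vec_carrier unit_vec_nonzero)
  ultimately show False by simp
qed

text \<open>From \<open>f = U V\<close> and \<open>L f R = 1\<close> it follows that \<open>(L U) (V R) = 1\<close>.\<close>

lemma rank_at_least_le_rank_at_most:
  assumes "rank_at_most f I J s" "rank_at_least f I J K" "finite K"
  shows "card K \<le> s"
proof -
  obtain u v where uv: "\<And>i j. i \<in> I \<Longrightarrow> j \<in> J \<Longrightarrow> f i j = (\<Sum>k<s. u k i * v k j)"
    using assms(1) unfolding rank_at_most_def by blast
  obtain L R where LR: "\<And>a b. a \<in> K \<Longrightarrow> b \<in> K \<Longrightarrow>
      (\<Sum>j\<in>J. (\<Sum>i\<in>I. L a i * f i j) * R b j) = (if a = b then 1 else 0)"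
    using assms(2) unfolding rank_at_least_def by blast
  obtain h where h: "bij_betw h {..<card K} K"
    using ex_bij_betw_nat_finite[OF assms(3)] by (auto simp: atLeast0LessThan)
  define x where "x a k = (\<Sum>i\<in>I. L (h a) i * u k i)" for a k
  define y where "y k b = (\<Sum>j\<in>J. v k j * R (h b) j)" for k b
  have eq: "(\<Sum>k<s. x a k * y k b) = (if a = b then 1 else 0)" if "a < card K" "b < card K" for a b
  proof -
    have "(\<Sum>i\<in>I. L (h a) i * f i j) = (\<Sum>k<s. x a k * v k j)" if "j \<in> J" for j
    proof -
      have "(\<Sum>i\<in>I. L (h a) i * f i j) = (\<Sum>i\<in>I. \<Sum>k<s. L (h a) i * u k i * v k j)"
        using that by (simp add: uv sum_distrib_left mult.assoc)
      also have "\<dots> = (\<Sum>k<s. \<Sum>i\<in>I. L (h a) i * u k i * v k j)"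
        by (rule sum.swap)
      finally show ?thesis by (simp add: x_def sum_distrib_right)
    qed
    then have "(\<Sum>j\<in>J. (\<Sum>i\<in>I. L (h a) i * f i j) * R (h b) j)
        = (\<Sum>j\<in>J. \<Sum>k<s. x a k * (v k j * R (h b) j))"
      by (simp add: sum_distrib_right mult.assoc)
    also have "\<dots> = (\<Sum>k<s. x a k * y k b)"
      by (subst sum.swap) (simp add: y_def sum_distrib_left)
    finally have "(\<Sum>k<s. x a k * y k b) = (if h a = h b then 1 else 0)"
      using LR[of "h a" "h b"] that bij_betwE[OF h] by simp
    moreover have "h a = h b \<longleftrightarrow> a = b"
      using h that by (auto simp: bij_betw_def inj_on_eq_iff)
    ultimately show ?thesis by simp
  qed
  show ?thesis
    by (rule identity_needs_dyads[where x = x and y = y]) (rule eq)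
qed

lemma rank_at_most_reindex:
  assumes \<alpha>: "bij_betw \<alpha> I' I" and \<beta>: "bij_betw \<beta> J' J"
  shows "rank_at_most (\<lambda>i j. f (\<alpha> i) (\<beta> j)) I' J' s \<longleftrightarrow> rank_at_most f I J s"
proof
  assume "rank_at_most f I J s"
  then obtain u v where "\<And>i j. i \<in> I \<Longrightarrow> j \<in> J \<Longrightarrow> f i j = (\<Sum>k<s. u k i * v k j)"
    unfolding rank_at_most_def by blast
  then show "rank_at_most (\<lambda>i j. f (\<alpha> i) (\<beta> j)) I' J' s"
    unfolding rank_at_most_def
    by (intro exI[of _ "\<lambda>k i. u k (\<alpha> i)"] exI[of _ "\<lambda>k j. v k (\<beta> j)"])
      (use \<alpha> \<beta> in \<open>auto dest: bij_betwE\<close>)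
next
  assume "rank_at_most (\<lambda>i j. f (\<alpha> i) (\<beta> j)) I' J' s"
  then obtain u v where uv: "\<And>i j. i \<in> I' \<Longrightarrow> j \<in> J' \<Longrightarrow> f (\<alpha> i) (\<beta> j) = (\<Sum>k<s. u k i * v k j)"
    unfolding rank_at_most_def by blast
  show "rank_at_most f I J s"
    unfolding rank_at_most_def
  proof (intro exI ballI)
    fix i j assume "i \<in> I" "j \<in> J"
    then show "f i j = (\<Sum>k<s. u k (inv_into I' \<alpha> i) * v k (inv_into J' \<beta> j))"
      using uv[of "inv_into I' \<alpha> i" "inv_into J' \<beta> j"] \<alpha> \<beta>
      by (simp add: bij_betw_inv_into_right inv_into_into bij_betw_imp_surj_on)
  qed
qed

text \<open>One row \<open>p\<close> is eliminated at a time. If row \<open>p\<close> has a nonzero entry \<open>c\<close> in column \<open>q\<close>, subtracting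
  the dyad \<open>f i q * f p j / c\<close> annihilates row \<open>p\<close> and column \<open>q\<close>. The dyad raises the upper
  certificate of the remainder by one; the lower certificate grows by the pair of \<open>p\<close> and \<open>q\<close>,
  after the old vectors have been made orthogonal to column \<open>q\<close> and row \<open>p\<close> of \<open>f\<close>.\<close>

lemma rank_bounds_meet:
  fixes f :: "'i \<Rightarrow> 'j \<Rightarrow> 'a::field"
  assumes "finite I" "finite J"
  shows "\<exists>r. rank_at_most f I J r \<and> rank_at_least f I J {..<r}"
  using assms(1)
proof (induction I arbitrary: f)
  case empty
  show ?case
    by (rule exI[of _ 0]) (simp add: rank_at_most_def rank_at_least_def)
next
  case (insert p I)
  have p: "p \<notin> I" "finite I" using insert by auto
  show ?case
  proof (cases "\<forall>j\<in>J. f p j = 0")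
    case True
    obtain r where r: "rank_at_most f I J r" "rank_at_least f I J {..<r}"
      using insert.IH[of f] by blast
    obtain u v where uv: "\<And>i j. i \<in> I \<Longrightarrow> j \<in> J \<Longrightarrow> f i j = (\<Sum>k<r. u k i * v k j)"
      using r(1) unfolding rank_at_most_def by blast
    obtain L R where LR: "\<And>a b. a \<in> {..<r} \<Longrightarrow> b \<in> {..<r} \<Longrightarrow>
        (\<Sum>j\<in>J. (\<Sum>i\<in>I. L a i * f i j) * R b j) = (if a = b then 1 else 0)"
      using r(2) unfolding rank_at_least_def by blast
    have "rank_at_most f (insert p I) J r"
      unfolding rank_at_most_def
      by (rule exI[of _ "\<lambda>k i. if i = p then 0 else u k i"], rule exI[of _ v])
        (use True uv p in \<open>auto intro!: sum.cong\<close>)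
    moreover have "rank_at_least f (insert p I) J {..<r}"
      unfolding rank_at_least_def
      by (rule exI[of _ L], rule exI[of _ R]) (use True LR p in auto)
    ultimately show ?thesis by blast
  next
    case False
    then obtain q where q: "q \<in> J" "f p q \<noteq> 0" by blast
    define c where "c = f p q"
    have c: "c \<noteq> 0" using q by (simp add: c_def)
    define g where "g i j = f i j - f i q * f p j / c" for i j
    have gq: "g i q = 0" for i using c by (simp add: g_def c_def)
    have gp: "g p j = 0" for j using c by (simp add: g_def c_def)
    have f_g: "f i j = g i j + f i q / c * f p j" for i j by (simp add: g_def)
    obtain r where r: "rank_at_most g I J r" "rank_at_least g I J {..<r}"
      using insert.IH[of g] by blast
    obtain u v where uv: "\<And>i j. i \<in> I \<Longrightarrow> j \<in> J \<Longrightarrow> g i j = (\<Sum>k<r. u k i * v k j)"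
      using r(1) unfolding rank_at_most_def by blast
    obtain L R where LR: "\<And>a b. a \<in> {..<r} \<Longrightarrow> b \<in> {..<r} \<Longrightarrow>
        (\<Sum>j\<in>J. (\<Sum>i\<in>I. L a i * g i j) * R b j) = (if a = b then 1 else 0)"
      using r(2) unfolding rank_at_least_def by blast
    have "rank_at_most f (insert p I) J (Suc r)"
      unfolding rank_at_most_def
    proof (intro exI ballI)
      fix i j assume ij: "i \<in> insert p I" "j \<in> J"
      let ?u = "\<lambda>k i. if k = r then f i q / c else if i = p then 0 else u k i"
      let ?v = "\<lambda>k j. if k = r then f p j else v k j"
      have "g i j = (\<Sum>k<r. ?u k i * ?v k j)"
        using ij uv gp by (cases "i = p") auto
      then show "f i j = (\<Sum>k<Suc r. ?u k i * ?v k j)"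
        by (subst f_g) simp
    qed
    moreover have "rank_at_least f (insert p I) J {..<Suc r}"
    proof -
      \<comment> \<open>\<open>L'\<close> and \<open>R'\<close> change the old vectors at \<open>p\<close> and \<open>q\<close> only; index \<open>r\<close> carries the new pair.\<close>
      define L' where "L' a i = (if a = r then (if i = p then 1 / c else 0)
        else if i = p then - (\<Sum>i\<in>I. L a i * f i q) / c else L a i)" for a i
      define R' where "R' b j = (if b = r then (if j = q then 1 else 0)
        else R b j - (if j = q then (\<Sum>j\<in>J. f p j * R b j) / c else 0))" for b j
      have rowsum: "(\<Sum>i\<in>insert p I. L' a i * f i j) =
          (if a = r then f p j / c else (\<Sum>i\<in>I. L a i * g i j))" for a j
      proof (cases "a = r")
        case True
        have "(\<Sum>i\<in>I. L' a i * f i j) = 0"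
          using True p by (intro sum.neutral) (auto simp: L'_def)
        then show ?thesis using True p by (simp add: L'_def)
      next
        case False
        have "(\<Sum>i\<in>I. L' a i * f i j) = (\<Sum>i\<in>I. L a i * f i j)"
          using False p by (intro sum.cong) (auto simp: L'_def)
        then show ?thesis using False p c
          by (simp add: L'_def g_def sum_subtractf right_diff_distrib sum_distrib_right
              sum_divide_distrib sum_negf mult.assoc)
      qed
      have colsum: "(\<Sum>j\<in>J. z j * R' b j) = (if b = r then z q
          else (\<Sum>j\<in>J. z j * R b j) - z q * (\<Sum>j\<in>J. f p j * R b j) / c)" for z b
      proof -
        have *: "(\<Sum>j\<in>J. z j * (if j = q then t else 0)) = z q * t" for t
          using q assms(2) by (simp add: if_distrib[of "\<lambda>t. _ * t"] cong: if_cong)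
        show ?thesis
          using *[of 1] * by (simp add: R'_def right_diff_distrib sum_subtractf)
      qed
      have "(\<Sum>j\<in>J. (\<Sum>i\<in>insert p I. L' a i * f i j) * R' b j) = (if a = b then 1 else 0)"
        if "a < Suc r" "b < Suc r" for a b
      proof (cases "a = r")
        case True
        then show ?thesis
          using c that by (simp add: rowsum colsum c_def[symmetric] sum_divide_distrib[symmetric])
      next
        case False
        then show ?thesis
          using LR[of a b] that by (cases "b = r") (simp_all add: rowsum colsum gq less_Suc_eq)
      qed
      then show ?thesis
        unfolding rank_at_least_def by (intro exI[of _ L'] exI[of _ R']) auto
    qed
    ultimately show ?thesis by blast
  qed
qed

text \<open>A sum of \<open>s\<close> dyads has rank at most \<open>s\<close> by subadditivity of the rank. Conversely, a maximal
  independent set of columns spans all columns, and the coefficients of the columns are the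
  second factors of the dyads.\<close>

lemma mat_rank_le_iff:
  "mat_rank A \<le> s \<longleftrightarrow> rank_at_most (\<lambda>i j. A $$ (i, j)) {..<dim_row A} {..<dim_col A} s"
proof
  let ?n = "dim_row A" and ?m = "dim_col A"
  interpret vec_space "TYPE('a)" ?n .
  have A: "A \<in> carrier_mat ?n ?m" by simp
  {
    assume "rank_at_most (\<lambda>i j. A $$ (i, j)) {..<?n} {..<?m} s"
    then obtain u v where uv: "\<And>i j. i < ?n \<Longrightarrow> j < ?m \<Longrightarrow> A $$ (i, j) = (\<Sum>k<s. u k i * v k j)"
      unfolding rank_at_most_def by auto
    have "rank (mat ?n ?m (\<lambda>(i, j). \<Sum>k<t. u k i * v k j)) \<le> t" for t
    proof (induction t)
      case 0
      have "mat ?n ?m (\<lambda>(i, j). \<Sum>k<0. u k i * v k j) = 0\<^sub>m ?n ?m" by auto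
      then show ?case by (simp only: rank_0I order_refl)
    next
      case (Suc t)
      let ?B = "mat ?n ?m (\<lambda>(i, j). \<Sum>k<t. u k i * v k j)"
      let ?C = "mat ?n ?m (\<lambda>(i, j). u t i * v t j)"
      have "mat ?n ?m (\<lambda>(i, j). \<Sum>k<Suc t. u k i * v k j) = ?B + ?C" by auto
      moreover have "rank (?B + ?C) \<le> rank ?B + rank ?C"
        by (rule rank_subadditive[where nc = ?m]) auto
      moreover have "rank ?C \<le> 1"
        by (rule rank_le_1_product_entries[where nc = ?m]) auto
      ultimately show ?case using Suc by simp
    qed
    from this[of s] have "rank (mat ?n ?m (\<lambda>(i, j). \<Sum>k<s. u k i * v k j)) \<le> s" .
    moreover have "mat ?n ?m (\<lambda>(i, j). \<Sum>k<s. u k i * v k j) = A"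
      by (rule eq_matI) (auto simp: uv)
    ultimately show "mat_rank A \<le> s" by (simp add: mat_rank_def)
  }
  assume le: "mat_rank A \<le> s"
  let ?P = "\<lambda>T. T \<subseteq> set (cols A) \<and> lin_indpt T"
  have "lin_indpt {}" by (rule finite_lin_indpt2) auto
  then obtain S where S: "maximal S ?P" "finite S"
    using maximal_exists_superset[of "set (cols A)" ?P "{}"] by auto
  have card: "card S \<le> s"
    using rank_card_indpt[OF A S(1)] le by (simp add: mat_rank_def)
  have sub: "S \<subseteq> set (cols A)" and indpt: "lin_indpt S"
    and max: "\<And>T. S \<subseteq> T \<Longrightarrow> T \<subseteq> set (cols A) \<Longrightarrow> lin_indpt T \<Longrightarrow> T = S"
    using S(1) unfolding maximal_def by auto
  have colsA: "set (cols A) \<subseteq> carrier_vec ?n" by (rule cols_dim)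
  then have SA: "S \<subseteq> carrier_vec ?n" using sub by blast
  have "\<exists>a. lincomb a S = col A j" if "j < ?m" for j
  proof -
    have cj: "col A j \<in> set (cols A)" using that by (auto simp: cols_def)
    have "col A j \<in> span S"
    proof (cases "col A j \<in> S")
      case True
      then show ?thesis using SA by (simp add: span_mem)
    next
      case False
      then have "lin_dep (S \<union> {col A j})"
        using max[of "S \<union> {col A j}"] cj sub by auto
      then show ?thesis
        using lin_dep_iff_in_span[of S "col A j"] False cj SA colsA indpt by auto
    qed
    then show ?thesis
      using finite_in_span[OF S(2), of "col A j"] SA by auto
  qed
  then obtain a where a: "\<And>j. j < ?m \<Longrightarrow> lincomb (a j) S = col A j" by metis
  obtain h where h: "bij_betw h {..<card S} S"
    using ex_bij_betw_nat_finite[OF S(2)] by (auto simp: atLeast0LessThan)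
  show "rank_at_most (\<lambda>i j. A $$ (i, j)) {..<?n} {..<?m} s"
    unfolding rank_at_most_def
  proof (intro exI ballI)
    fix i j assume "i \<in> {..<?n}" "j \<in> {..<?m}"
    then have ij: "i < ?n" "j < ?m" by auto
    \<comment> \<open>The basis may have fewer than \<open>s\<close> vectors, so zero dyads fill up the sum.\<close>
    let ?u = "\<lambda>k i. if k < card S then h k $ i else 0" and ?v = "\<lambda>k j. a j (h k)"
    have "A $$ (i, j) = lincomb (a j) S $ i" using ij a by simp
    also have "\<dots> = (\<Sum>x\<in>S. a j x * x $ i)"
      using ij SA by (intro lincomb_index) auto
    also have "\<dots> = (\<Sum>k<card S. a j (h k) * h k $ i)"
      using sum.reindex_bij_betw[OF h, of "\<lambda>x. a j x * x $ i"] by simp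
    also have "\<dots> = (\<Sum>k<s. ?u k i * ?v k j)"
      using card by (intro sum.mono_neutral_cong_left) (auto simp: mult.commute)
    finally show "A $$ (i, j) = (\<Sum>k<s. ?u k i * ?v k j)" .
  qed
qed

text \<open>The common value of both certificates can only be the rank.\<close>

lemma rank_at_least_mat_rank:
  "rank_at_least (\<lambda>i j. A $$ (i, j)) {..<dim_row A} {..<dim_col A} {..<mat_rank A}"
proof -
  let ?f = "\<lambda>i j. A $$ (i, j)" and ?I = "{..<dim_row A}" and ?J = "{..<dim_col A}"
  obtain r where r: "rank_at_most ?f ?I ?J r" "rank_at_least ?f ?I ?J {..<r}"
    using rank_bounds_meet[of ?I ?J ?f] by auto
  have "card {..<r} \<le> mat_rank A"
    using r(2) by (rule rank_at_least_le_rank_at_most[rotated]) (simp_all flip: mat_rank_le_iff)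
  moreover have "mat_rank A \<le> r" using r(1) by (simp add: mat_rank_le_iff)
  ultimately show ?thesis using r(2) by simp
qed

section \<open>Multi-indices and Kronecker products\<close>

lemma multi_indices_Cons:
  "multi_indices (n # ns) = (\<lambda>(x, xs). x # xs) ` ({..<n} \<times> multi_indices ns)"
  by (auto simp: multi_indices_def image_iff length_Suc_conv All_less_Suc2)

lemma multi_indices_append:
  assumes "is \<in> multi_indices ms" "js \<in> multi_indices ns"
  shows "is @ js \<in> multi_indices (ms @ ns)"
  using assms by (auto simp: multi_indices_def nth_append)

lemma finite_multi_indices: "finite (multi_indices ns)"
  by (simp flip: set_multi_index_list)

lemma bij_betw_multi_index_list:
  "bij_betw ((!) (multi_index_list ns)) {..<prod_list ns} (multi_indices ns)"
  by (rule bij_betw_nth)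
    (simp_all add: distinct_multi_index_list set_multi_index_list length_multi_index_list)

lemma card_multi_indices: "card (multi_indices ns) = prod_list ns"
  using bij_betw_same_card[OF bij_betw_multi_index_list[of ns]] by simp

lemma prod_sum_multi_indices:
  fixes f :: "nat \<Rightarrow> nat \<Rightarrow> 'a::comm_semiring_1"
  shows "(\<Prod>m<length ns. \<Sum>x<ns ! m. f m x) = (\<Sum>xs\<in>multi_indices ns. \<Prod>m<length ns. f m (xs ! m))"
proof (induction ns arbitrary: f)
  case Nil
  then show ?case by (simp add: multi_indices_def)
next
  case (Cons n ns)
  have "(\<Sum>xs\<in>multi_indices (n # ns). \<Prod>m<length (n # ns). f m (xs ! m)) =
      (\<Sum>(x, xs)\<in>{..<n} \<times> multi_indices ns. f 0 x * (\<Prod>m<length ns. f (Suc m) (xs ! m)))"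
    unfolding multi_indices_Cons
    by (subst sum.reindex)
      (auto simp: inj_on_def prod.lessThan_Suc_shift case_prod_unfold simp del: prod.lessThan_Suc)
  also have "\<dots> = (\<Sum>x<n. f 0 x) * (\<Sum>xs\<in>multi_indices ns. \<Prod>m<length ns. f (Suc m) (xs ! m))"
    by (simp add: sum_product sum.cartesian_product)
  also have "\<dots> = (\<Prod>m<length (n # ns). \<Sum>x<(n # ns) ! m. f m x)"
    by (simp add: Cons.IH[of "\<lambda>m. f (Suc m)", symmetric] prod.lessThan_Suc_shift del: prod.lessThan_Suc)
  finally show ?case by simp
qed

lemma prod_pairs:
  fixes f :: "nat \<Rightarrow> 'a::comm_monoid_mult"
  shows "(\<Prod>k<2 * d. f k) = (\<Prod>m<d. f (2 * m) * f (2 * m + 1))"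
  by (induction d) (simp_all add: mult.assoc)

text \<open>The products of the vectors in the factors' certificates form a certificate: all sums over
  multi-indices factor into products of sums over single indices.\<close>

lemma rank_at_least_kronecker:
  assumes "length ms = length rs" "length ns = length rs"
    and "\<And>m. m < length rs \<Longrightarrow> rank_at_least (f m) {..<ms ! m} {..<ns ! m} {..<rs ! m}"
  shows "rank_at_least (\<lambda>is js. \<Prod>m<length rs. f m (is ! m) (js ! m))
    (multi_indices ms) (multi_indices ns) (multi_indices rs)"
proof -
  have "\<forall>m. \<exists>L R. m < length rs \<longrightarrow> (\<forall>a<rs ! m. \<forall>b<rs ! m.
      (\<Sum>j<ns ! m. (\<Sum>i<ms ! m. L a i * f m i j) * R b j) = (if a = b then 1 else 0))"
    using assms(3) unfolding rank_at_least_def by (simp add: Ball_def)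
  from choice[OF this] obtain L where "\<forall>m. \<exists>R. m < length rs \<longrightarrow> (\<forall>a<rs ! m. \<forall>b<rs ! m.
      (\<Sum>j<ns ! m. (\<Sum>i<ms ! m. L m a i * f m i j) * R b j) = (if a = b then 1 else 0))" ..
  from choice[OF this] obtain R where LR: "\<forall>m. m < length rs \<longrightarrow> (\<forall>a<rs ! m. \<forall>b<rs ! m.
      (\<Sum>j<ns ! m. (\<Sum>i<ms ! m. L m a i * f m i j) * R m b j) = (if a = b then 1 else 0))" ..
  show ?thesis
    unfolding rank_at_least_def
  proof (intro exI ballI)
    fix a b assume ab: "a \<in> multi_indices rs" "b \<in> multi_indices rs"
    let ?L = "\<lambda>a is. \<Prod>m<length rs. L m (a ! m) (is ! m)"
    let ?R = "\<lambda>b js. \<Prod>m<length rs. R m (b ! m) (js ! m)"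
    have "(\<Sum>js\<in>multi_indices ns. (\<Sum>is\<in>multi_indices ms.
            ?L a is * (\<Prod>m<length rs. f m (is ! m) (js ! m))) * ?R b js)
        = (\<Sum>js\<in>multi_indices ns. \<Prod>m<length rs.
            (\<Sum>i<ms ! m. L m (a ! m) i * f m i (js ! m)) * R m (b ! m) (js ! m))"
    proof (rule sum.cong)
      fix js
      show "(\<Sum>is\<in>multi_indices ms. ?L a is * (\<Prod>m<length rs. f m (is ! m) (js ! m))) * ?R b js =
          (\<Prod>m<length rs. (\<Sum>i<ms ! m. L m (a ! m) i * f m i (js ! m)) * R m (b ! m) (js ! m))"
        using prod_sum_multi_indices[of "\<lambda>m i. L m (a ! m) i * f m i (js ! m)" ms] assms(1)
        by (simp add: prod.distrib)
    qed simp
    also have "\<dots> = (\<Prod>m<length rs. \<Sum>j<ns ! m.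
        (\<Sum>i<ms ! m. L m (a ! m) i * f m i j) * R m (b ! m) j)"
      using prod_sum_multi_indices[of "\<lambda>m j. (\<Sum>i<ms ! m. L m (a ! m) i * f m i j) * R m (b ! m) j" ns]
        assms(2) by simp
    also have "\<dots> = (\<Prod>m<length rs. if a ! m = b ! m then 1 else 0)"
      using ab by (intro prod.cong) (auto simp: LR multi_indices_def)
    also have "\<dots> = (if a = b then 1 else 0)"
    proof (cases "a = b")
      case False
      then obtain m where "m < length rs" "a ! m \<noteq> b ! m"
        using ab by (auto simp: multi_indices_def list_eq_iff_nth_eq)
      then show ?thesis using False by (auto intro!: prod_zero)
    qed simp
    finally show "(\<Sum>js\<in>multi_indices ns. (\<Sum>is\<in>multi_indices ms.
            ?L a is * (\<Prod>m<length rs. f m (is ! m) (js ! m))) * ?R b js)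
        = (if a = b then 1 else 0)" .
  qed
qed

section \<open>Entries of unfoldings and outer products\<close>

text \<open>Numbering rows and columns by positions in the list of multi-indices does not affect
  factorizations, so the unfolding can be treated as indexed by multi-indices.\<close>

lemma mat_rank_square_unfolding_le_iff:
  fixes G :: "'a::field tensor"
  defines "h \<equiv> length (dims G) div 2"
  shows "mat_rank (square_unfolding G) \<le> s \<longleftrightarrow>
    rank_at_most (\<lambda>is js. entry G (is @ js))
      (multi_indices (take h (dims G))) (multi_indices (drop h (dims G))) s"
proof -
  let ?rows = "take h (dims G)" and ?cols = "drop h (dims G)"
  have "square_unfolding G = mat (prod_list ?rows) (prod_list ?cols)
      (\<lambda>(i, j). entry G (multi_index_list ?rows ! i @ multi_index_list ?cols ! j))"
    by (simp add: square_unfolding_def Let_def h_def)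
  then have "mat_rank (square_unfolding G) \<le> s \<longleftrightarrow>
      rank_at_most (\<lambda>i j. entry G (multi_index_list ?rows ! i @ multi_index_list ?cols ! j))
        {..<prod_list ?rows} {..<prod_list ?cols} s"
    unfolding mat_rank_le_iff rank_at_most_def by simp
  also have "\<dots> \<longleftrightarrow> rank_at_most (\<lambda>is js. entry G (is @ js)) (multi_indices ?rows) (multi_indices ?cols) s"
    by (rule rank_at_most_reindex[OF bij_betw_multi_index_list bij_betw_multi_index_list])
  finally show ?thesis .
qed

lemma dims_tensor_of_vec_list: "dims (tensor_outer_list (map tensor_of_vec vs)) = map dim_vec vs"
  by (induction vs) (simp_all add: tensor_outer_list_def tensor_outer_def tensor_of_vec_def)

lemma entry_tensor_of_vec_list:
  assumes "is \<in> multi_indices (map dim_vec vs)"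
  shows "entry (tensor_outer_list (map tensor_of_vec vs)) is = (\<Prod>k<length vs. vs ! k $ (is ! k))"
  using assms
proof (induction vs arbitrary: "is")
  case Nil
  then show ?case by (simp add: tensor_outer_list_def)
next
  case (Cons v vs)
  then obtain x xs where xs: "is = x # xs" "x < dim_vec v" "xs \<in> multi_indices (map dim_vec vs)"
    by (auto simp: multi_indices_Cons)
  have "entry (tensor_outer_list (map tensor_of_vec (v # vs))) is =
      v $ x * entry (tensor_outer_list (map tensor_of_vec vs)) xs"
    using Cons.prems xs(1,2) dims_tensor_of_vec_list[of vs]
    by (simp add: tensor_outer_list_def tensor_outer_def tensor_of_vec_def multi_indices_def)
  then show ?case
    using Cons.IH[OF xs(3)] xs(1)
    by (simp add: prod.lessThan_Suc_shift del: prod.lessThan_Suc)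
qed

lemma dims_tensor_of_mat_list:
  "dims (tensor_outer_list (map tensor_of_mat As)) = concat (map (\<lambda>A. [dim_row A, dim_col A]) As)"
  by (induction As) (simp_all add: tensor_outer_list_def tensor_outer_def tensor_of_mat_def)

lemma entry_tensor_of_mat_list:
  assumes "is \<in> multi_indices (concat (map (\<lambda>A. [dim_row A, dim_col A]) As))"
  shows "entry (tensor_outer_list (map tensor_of_mat As)) is =
    (\<Prod>m<length As. As ! m $$ (is ! (2 * m), is ! (2 * m + 1)))"
  using assms
proof (induction As arbitrary: "is")
  case Nil
  then show ?case by (simp add: tensor_outer_list_def)
next
  case (Cons A As)
  then obtain x y xs where xs: "is = x # y # xs" "x < dim_row A" "y < dim_col A"
      "xs \<in> multi_indices (concat (map (\<lambda>A. [dim_row A, dim_col A]) As))"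
    by (auto simp: multi_indices_Cons)
  have *: "[x, y] \<in> multi_indices [dim_row A, dim_col A]"
    using xs by (auto simp: multi_indices_Cons multi_indices_def[of "[]"])
  have "entry (tensor_outer_list (map tensor_of_mat (A # As))) is =
      A $$ (x, y) * entry (tensor_outer_list (map tensor_of_mat As)) xs"
    using Cons.prems xs(1) * dims_tensor_of_mat_list[of As]
    by (simp add: tensor_outer_list_def tensor_outer_def tensor_of_mat_def)
  then show ?case
    using Cons.IH[OF xs(4)] xs(1)
    by (simp add: prod.lessThan_Suc_shift del: prod.lessThan_Suc)
qed

lemma nth_dim_pairs:
  fixes As :: "'a mat list"
  assumes "m < length As"
  shows "concat (map (\<lambda>A. [dim_row A, dim_col A]) As) ! (2 * m) = dim_row (As ! m)"
    and "concat (map (\<lambda>A. [dim_row A, dim_col A]) As) ! (2 * m + 1) = dim_col (As ! m)"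
  using assms
proof (induction As arbitrary: m)
  case (Cons A As)
  {
    case 1
    then show ?case using Cons.IH(1) by (cases m) auto
  next
    case 2
    then show ?case using Cons.IH(2) by (cases m) auto
  }
qed auto

lemma length_dim_pairs: "length (concat (map (\<lambda>A. [dim_row A, dim_col A]) As)) = 2 * length As"
  by (induction As) auto

section \<open>The CP-rank bounds all unfoldings\<close>

text \<open>CP decompositions read off entrywise: \<open>a k i\<close> is the \<open>k\<close>-th factor of the \<open>i\<close>-th term, as a
  function of the index. Functions instead of vectors, so that permuting and regrouping the
  factors involves no dimensions.\<close>

definition cp_rank_at_most :: "complex tensor \<Rightarrow> nat \<Rightarrow> bool" where
  "cp_rank_at_most F r \<longleftrightarrow> (\<exists>a. \<forall>is\<in>multi_indices (dims F).
     entry F is = (\<Sum>i<r. \<Prod>k<length (dims F). a k i (is ! k)))"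

lemma cp_rank_eq_Least: "cp_rank F = (LEAST r. cp_rank_at_most F r)"
proof -
  let ?ns = "dims F"
  let ?T = "\<lambda>a r. tensor_sum ?ns r
    (\<lambda>i. tensor_outer_list (map (\<lambda>k. tensor_of_vec (a k i)) [0..<length ?ns]))"
  have entry_T: "entry (?T a r) is = (\<Sum>i<r. \<Prod>k<length ?ns. a k i $ (is ! k))"
    if "\<forall>i<r. \<forall>k<length ?ns. a k i \<in> carrier_vec (?ns ! k)" "is \<in> multi_indices ?ns"
    for a :: "nat \<Rightarrow> nat \<Rightarrow> complex vec" and r "is"
  proof -
    have "entry (tensor_outer_list (map (\<lambda>k. tensor_of_vec (a k i)) [0..<length ?ns])) is =
        (\<Prod>k<length ?ns. a k i $ (is ! k))" if "i < r" for i
    proof -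
      let ?vs = "map (\<lambda>k. a k i) [0..<length ?ns]"
      have "map dim_vec ?vs = ?ns"
        using \<open>\<forall>i<r. _ i\<close> that by (auto intro!: nth_equalityI)
      then show ?thesis
        using entry_tensor_of_vec_list[of "is" ?vs] \<open>is \<in> _\<close> by (simp add: comp_def)
    qed
    then show ?thesis
      using that by (simp add: tensor_sum_def)
  qed
  have "(\<exists>a. (\<forall>i<r. \<forall>k<length ?ns. a k i \<in> carrier_vec (?ns ! k)) \<and> F = ?T a r) \<longleftrightarrow>
      cp_rank_at_most F r" for r
  proof
    assume "\<exists>a. (\<forall>i<r. \<forall>k<length ?ns. a k i \<in> carrier_vec (?ns ! k)) \<and> F = ?T a r"
    then obtain a where a: "\<forall>i<r. \<forall>k<length ?ns. a k i \<in> carrier_vec (?ns ! k)" "F = ?T a r"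
      by blast
    have "\<forall>is\<in>multi_indices ?ns. entry F is = (\<Sum>i<r. \<Prod>k<length ?ns. a k i $ (is ! k))"
      using entry_T[OF a(1)] by (simp flip: a(2))
    then show "cp_rank_at_most F r"
      unfolding cp_rank_at_most_def by (intro exI[of _ "\<lambda>k i x. a k i $ x"])
  next
    assume "cp_rank_at_most F r"
    then obtain a where a: "\<And>is. is \<in> multi_indices ?ns \<Longrightarrow>
        entry F is = (\<Sum>i<r. \<Prod>k<length ?ns. a k i (is ! k))"
      unfolding cp_rank_at_most_def by blast
    let ?a = "\<lambda>k i. vec (?ns ! k) (a k i)"
    have "F = ?T ?a r"
    proof (rule tensor_eqI)
      show "dims F = dims (?T ?a r)" by (simp add: tensor_sum_def)
      fix "is" assume "is \<in> multi_indices (dims (?T ?a r))"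
      then have is_in: "is \<in> multi_indices ?ns" by (simp add: tensor_sum_def)
      then have "\<And>k. k < length ?ns \<Longrightarrow> is ! k < ?ns ! k" by (simp add: multi_indices_def)
      then show "entry F is = entry (?T ?a r) is"
        using is_in by (simp add: a entry_T)
    qed
    then show "\<exists>a. (\<forall>i<r. \<forall>k<length ?ns. a k i \<in> carrier_vec (?ns ! k)) \<and> F = ?T a r"
      by (intro exI[of _ ?a]) auto
  qed
  then show ?thesis unfolding cp_rank_def by simp
qed

lemma multi_indices_permute_inv:
  assumes \<pi>: "\<pi> permutes {..<length ns}" and "is \<in> multi_indices (permute_list \<pi> ns)"
  shows "permute_list (Hilbert_Choice.inv \<pi>) is \<in> multi_indices ns"
    and "k < length ns \<Longrightarrow> permute_list (Hilbert_Choice.inv \<pi>) is ! k = is ! Hilbert_Choice.inv \<pi> k"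
proof -
  have len: "length is = length ns"
    using assms(2) by (simp add: multi_indices_def)
  have inv: "Hilbert_Choice.inv \<pi> permutes {..<length is}"
    using permutes_inv[OF \<pi>] len by simp
  show nth: "permute_list (Hilbert_Choice.inv \<pi>) is ! k = is ! Hilbert_Choice.inv \<pi> k"
    if "k < length ns" for k
    using permute_list_nth[OF inv] that len by simp
  have "is ! Hilbert_Choice.inv \<pi> k < ns ! k" if k: "k < length ns" for k
  proof -
    have "Hilbert_Choice.inv \<pi> k < length ns"
      using permutes_in_image[OF inv, of k] k len by simp
    then show ?thesis
      using assms(2) permute_list_nth[OF \<pi>, of "Hilbert_Choice.inv \<pi> k"] permutes_inverses(1)[OF \<pi>]
      by (auto simp: multi_indices_def)
  qed
  then show "permute_list (Hilbert_Choice.inv \<pi>) is \<in> multi_indices ns"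
    using len nth by (simp add: multi_indices_def)
qed

text \<open>The factor in position \<open>k\<close> of a term for the permuted tensor is the original factor in position
  \<open>\<pi> k\<close>.\<close>

lemma cp_rank_at_most_permute_tensor:
  assumes "cp_rank_at_most F r" and \<pi>: "\<pi> permutes {..<length (dims F)}"
  shows "cp_rank_at_most (permute_tensor \<pi> F) r"
proof -
  let ?n = "length (dims F)"
  obtain a where a: "\<And>is. is \<in> multi_indices (dims F) \<Longrightarrow>
      entry F is = (\<Sum>i<r. \<Prod>k<?n. a k i (is ! k))"
    using assms(1) unfolding cp_rank_at_most_def by blast
  show ?thesis
    unfolding cp_rank_at_most_def
  proof (intro exI ballI)
    fix "is" assume "is \<in> multi_indices (dims (permute_tensor \<pi> F))"
    then have is_in: "is \<in> multi_indices (permute_list \<pi> (dims F))"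
      by (simp add: permute_tensor_def)
    have "entry (permute_tensor \<pi> F) is = entry F (permute_list (Hilbert_Choice.inv \<pi>) is)"
      using is_in by (simp add: permute_tensor_def)
    also have "\<dots> = (\<Sum>i<r. \<Prod>k<?n. a k i (is ! Hilbert_Choice.inv \<pi> k))"
      using multi_indices_permute_inv[OF \<pi> is_in] by (simp add: a)
    also have "\<dots> = (\<Sum>i<r. \<Prod>k<?n. a (\<pi> k) i (is ! k))"
    proof (intro sum.cong)
      fix i
      show "(\<Prod>k<?n. a k i (is ! Hilbert_Choice.inv \<pi> k)) = (\<Prod>k<?n. a (\<pi> k) i (is ! k))"
        using prod.reindex_bij_betw[OF permutes_imp_bij[OF \<pi>], of "\<lambda>k. a k i (is ! Hilbert_Choice.inv \<pi> k)"]
        by (simp add: permutes_inverses(2)[OF \<pi>])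
    qed simp
    finally show "entry (permute_tensor \<pi> F) is =
        (\<Sum>i<r. \<Prod>k<length (dims (permute_tensor \<pi> F)). a (\<pi> k) i (is ! k))"
      by (simp add: permute_tensor_def)
  qed
qed

text \<open>The entry of a rank-one tensor at \<open>is @ js\<close> splits into a product depending on \<open>is\<close> and one
  depending on \<open>js\<close>.\<close>

lemma mat_rank_square_unfolding_le:
  assumes "cp_rank_at_most G r"
  shows "mat_rank (square_unfolding G) \<le> r"
proof -
  let ?n = "length (dims G)"
  let ?h = "?n div 2"
  obtain a where a: "\<And>is. is \<in> multi_indices (dims G) \<Longrightarrow>
      entry G is = (\<Sum>i<r. \<Prod>k<?n. a k i (is ! k))"
    using assms unfolding cp_rank_at_most_def by blast
  have "rank_at_most (\<lambda>is js. entry G (is @ js))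
      (multi_indices (take ?h (dims G))) (multi_indices (drop ?h (dims G))) r"
    unfolding rank_at_most_def
  proof (intro exI ballI)
    fix "is" js assume ij: "is \<in> multi_indices (take ?h (dims G))" "js \<in> multi_indices (drop ?h (dims G))"
    then have len: "length is = ?h" by (simp add: multi_indices_def)
    have "is @ js \<in> multi_indices (dims G)" using multi_indices_append[OF ij] by simp
    then have "entry G (is @ js) = (\<Sum>i<r. \<Prod>k<?n. a k i ((is @ js) ! k))" by (rule a)
    also have "\<dots> = (\<Sum>i<r. (\<Prod>k<?h. a k i (is ! k)) * (\<Prod>k=?h..<?n. a k i (js ! (k - ?h))))"
    proof (rule sum.cong)
      fix i
      have "(\<Prod>k<?n. a k i ((is @ js) ! k)) =
          (\<Prod>k<?h. a k i ((is @ js) ! k)) * (\<Prod>k=?h..<?n. a k i ((is @ js) ! k))"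
        using prod.atLeastLessThan_concat[of 0 ?h ?n "\<lambda>k. a k i ((is @ js) ! k)"]
        by (simp add: lessThan_atLeast0)
      then show "(\<Prod>k<?n. a k i ((is @ js) ! k)) =
          (\<Prod>k<?h. a k i (is ! k)) * (\<Prod>k=?h..<?n. a k i (js ! (k - ?h)))"
        using len by (simp add: nth_append)
    qed simp
    finally show "entry G (is @ js) =
        (\<Sum>i<r. (\<Prod>k<?h. a k i (is ! k)) * (\<Prod>k=?h..<?n. a k i (js ! (k - ?h))))" .
  qed
  then show ?thesis by (simp add: mat_rank_square_unfolding_le_iff)
qed

section \<open>Outer products of matrices\<close>

text \<open>The terms of the decomposition are indexed by the multi-indices \<open>ks\<close> of shape
  \<open>r\<^sub>1, \<dots>, r\<^sub>d\<close>, which choose one dyad \<open>u m (ks ! m)\<close>, \<open>v m (ks ! m)\<close> from each matrix.\<close>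

lemma cp_rank_at_most_mat_product:
  assumes "F = tensor_outer_list (map tensor_of_mat As)"
  shows "cp_rank_at_most F (\<Prod>m<length As. mat_rank (As ! m))"
proof -
  let ?d = "length As"
  let ?rs = "map mat_rank As"
  have dims: "dims F = concat (map (\<lambda>A. [dim_row A, dim_col A]) As)"
    using assms by (simp add: dims_tensor_of_mat_list)
  have len: "length (dims F) = 2 * ?d" by (simp add: dims length_dim_pairs)
  have "\<exists>u v. \<forall>i<dim_row (As ! m). \<forall>j<dim_col (As ! m).
      As ! m $$ (i, j) = (\<Sum>k<?rs ! m. u k i * v k j)" if "m < ?d" for m
    using that mat_rank_le_iff[of "As ! m" "?rs ! m"] by (simp add: rank_at_most_def Ball_def)
  then obtain u v where uv: "\<And>m i j. m < ?d \<Longrightarrow> i < dim_row (As ! m) \<Longrightarrow> j < dim_col (As ! m) \<Longrightarrow>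
      As ! m $$ (i, j) = (\<Sum>k<?rs ! m. u m k i * v m k j)"
    by metis
  define K where "K = (!) (multi_index_list ?rs)"
  \<comment> \<open>Even positions of the tensor are row indices and odd positions are column indices.\<close>
  define a where "a k i = (if even k then u (k div 2) (K i ! (k div 2)) else v (k div 2) (K i ! (k div 2)))" for k i
  have pl: "prod_list ?rs = (\<Prod>m<?d. mat_rank (As ! m))"
    by (simp add: prod.list_conv_set_nth lessThan_atLeast0)
  have "entry F is = (\<Sum>i<prod_list ?rs. \<Prod>k<2 * ?d. a k i (is ! k))" if is_in: "is \<in> multi_indices (dims F)" for "is"
  proof -
    have lt: "is ! k < dims F ! k" if "k < 2 * ?d" for k
      using is_in that len by (simp add: multi_indices_def)
    have bound: "is ! (2 * m) < dim_row (As ! m)" "is ! (2 * m + 1) < dim_col (As ! m)"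
      if "m < ?d" for m
      using lt[of "2 * m"] lt[of "2 * m + 1"] nth_dim_pairs[OF that] that by (simp_all add: dims)
    have "entry F is = (\<Prod>m<?d. As ! m $$ (is ! (2 * m), is ! (2 * m + 1)))"
      unfolding assms by (rule entry_tensor_of_mat_list) (use is_in dims in simp)
    also have "\<dots> = (\<Prod>m<?d. \<Sum>k<?rs ! m. u m k (is ! (2 * m)) * v m k (is ! (2 * m + 1)))"
      using bound by (intro prod.cong) (auto simp: uv)
    also have "\<dots> = (\<Sum>ks\<in>multi_indices ?rs. \<Prod>m<?d. u m (ks ! m) (is ! (2 * m)) * v m (ks ! m) (is ! (2 * m + 1)))"
      using prod_sum_multi_indices[of "\<lambda>m k. u m k (is ! (2 * m)) * v m k (is ! (2 * m + 1))" ?rs] by simp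
    also have "\<dots> = (\<Sum>i<prod_list ?rs. \<Prod>m<?d. u m (K i ! m) (is ! (2 * m)) * v m (K i ! m) (is ! (2 * m + 1)))"
      unfolding K_def by (rule sum.reindex_bij_betw[OF bij_betw_multi_index_list, symmetric])
    also have "\<dots> = (\<Sum>i<prod_list ?rs. \<Prod>k<2 * ?d. a k i (is ! k))"
      by (simp add: prod_pairs a_def)
    finally show ?thesis .
  qed
  then show ?thesis
    unfolding cp_rank_at_most_def len pl by blast
qed

text \<open>The permutation for which the unfolding is a Kronecker product: the row indices of the matrices,
  at the even positions, go to the first half and the column indices to the second.\<close>

definition deinterleave :: "nat \<Rightarrow> nat \<Rightarrow> nat" where
  "deinterleave d k = (if k < d then 2 * k else if k < 2 * d then 2 * (k - d) + 1 else k)"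

lemma deinterleave_permutes: "deinterleave d permutes {..<2 * d}"
proof (rule bij_imp_permutes)
  show "bij_betw (deinterleave d) {..<2 * d} {..<2 * d}"
    by (rule bij_betw_byWitness[where f' = "\<lambda>k. if even k then k div 2 else d + k div 2"])
      (auto simp: deinterleave_def elim!: evenE oddE)
qed (simp add: deinterleave_def)

text \<open>The unfolding has the entry \<open>\<Prod>m. A\<^sub>m (is ! m, js ! m)\<close> at \<open>(is, js)\<close>, hence it is the Kronecker
  product, and multiplying the lower certificates of the \<open>A\<^sub>m\<close> bounds its rank from below.\<close>

lemma mat_rank_deinterleaved_ge:
  assumes "F = tensor_outer_list (map tensor_of_mat As)"
  shows "(\<Prod>m<length As. mat_rank (As ! m)) \<le>
    mat_rank (square_unfolding (permute_tensor (deinterleave (length As)) F))"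
proof -
  let ?d = "length As"
  let ?\<pi> = "deinterleave ?d"
  let ?G = "permute_tensor ?\<pi> F"
  let ?ms = "map dim_row As" and ?ns = "map dim_col As" and ?rs = "map mat_rank As"
  have dims: "dims F = concat (map (\<lambda>A. [dim_row A, dim_col A]) As)"
    using assms by (simp add: dims_tensor_of_mat_list)
  have len: "length (dims F) = 2 * ?d" by (simp add: dims length_dim_pairs)
  have \<pi>: "?\<pi> permutes {..<length (dims F)}"
    unfolding len by (rule deinterleave_permutes)
  have dG: "dims ?G = ?ms @ ?ns"
  proof (rule nth_equalityI)
    fix k assume "k < length (dims ?G)"
    then have k: "k < 2 * ?d" by (simp add: permute_tensor_def len)
    then have "dims ?G ! k = dims F ! ?\<pi> k"
      using permute_list_nth[OF \<pi>] len by (simp add: permute_tensor_def)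
    then show "dims ?G ! k = (?ms @ ?ns) ! k"
      using k nth_dim_pairs[of k As] nth_dim_pairs[of "k - ?d" As]
      by (auto simp: dims deinterleave_def nth_append)
  qed (simp add: permute_tensor_def len)
  have entry: "entry ?G (is @ js) = (\<Prod>m<?d. As ! m $$ (is ! m, js ! m))"
    if "is \<in> multi_indices ?ms" "js \<in> multi_indices ?ns" for "is" js
  proof -
    have lens: "length is = ?d" "length js = ?d" using that by (simp_all add: multi_indices_def)
    let ?ks = "permute_list (Hilbert_Choice.inv ?\<pi>) (is @ js)"
    have ij: "is @ js \<in> multi_indices (permute_list ?\<pi> (dims F))"
      using multi_indices_append[OF that] dG by (simp add: permute_tensor_def)
    have "?ks ! (2 * m) = is ! m \<and> ?ks ! (2 * m + 1) = js ! m" if "m < ?d" for m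
    proof -
      have "?\<pi> m = 2 * m" "?\<pi> (?d + m) = 2 * m + 1"
        using that by (simp_all add: deinterleave_def)
      then have "Hilbert_Choice.inv ?\<pi> (2 * m) = m" "Hilbert_Choice.inv ?\<pi> (2 * m + 1) = ?d + m"
        using permutes_inverses(2)[OF \<pi>] by metis+
      then show ?thesis
        using multi_indices_permute_inv(2)[OF \<pi> ij] that lens len by (simp add: nth_append)
    qed
    moreover have "entry F ?ks = (\<Prod>m<?d. As ! m $$ (?ks ! (2 * m), ?ks ! (2 * m + 1)))"
      unfolding assms
      by (rule entry_tensor_of_mat_list) (use multi_indices_permute_inv(1)[OF \<pi> ij] dims in simp)
    moreover have "entry ?G (is @ js) = entry F ?ks"
      using ij by (simp add: permute_tensor_def)
    ultimately show ?thesis by simp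
  qed
  let ?s = "mat_rank (square_unfolding ?G)"
  have "rank_at_most (\<lambda>is js. entry ?G (is @ js)) (multi_indices ?ms) (multi_indices ?ns) ?s"
    using mat_rank_square_unfolding_le_iff[of ?G ?s] by (simp add: dG)
  then have "rank_at_most (\<lambda>is js. \<Prod>m<?d. As ! m $$ (is ! m, js ! m)) (multi_indices ?ms) (multi_indices ?ns) ?s"
    unfolding rank_at_most_def by (simp add: entry)
  moreover have "rank_at_least (\<lambda>is js. \<Prod>m<length ?rs. As ! m $$ (is ! m, js ! m))
      (multi_indices ?ms) (multi_indices ?ns) (multi_indices ?rs)"
    by (rule rank_at_least_kronecker) (simp_all add: rank_at_least_mat_rank)
  then have "rank_at_least (\<lambda>is js. \<Prod>m<?d. As ! m $$ (is ! m, js ! m))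
      (multi_indices ?ms) (multi_indices ?ns) (multi_indices ?rs)"
    by simp
  ultimately have "card (multi_indices ?rs) \<le> ?s"
    by (rule rank_at_least_le_rank_at_most) (rule finite_multi_indices)
  then show ?thesis
    by (simp add: card_multi_indices prod.list_conv_set_nth lessThan_atLeast0)
qed

lemma ranks_of_mat_product:
  assumes "F = tensor_outer_list (map tensor_of_mat As)"
  shows "cp_rank F = (\<Prod>m<length As. mat_rank (As ! m))"
    and "mplus_rank F = (\<Prod>m<length As. mat_rank (As ! m))"
proof -
  let ?p = "\<Prod>m<length As. mat_rank (As ! m)"
  let ?M = "{mat_rank (square_unfolding (permute_tensor \<pi> F)) | \<pi>. \<pi> permutes {..<length (dims F)}}"
  have len: "length (dims F) = 2 * length As"
    using assms by (simp add: dims_tensor_of_mat_list length_dim_pairs)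
  have fin: "finite ?M"
    using finite_imageI[OF finite_permutations[of "{..<length (dims F)}"],
        of "\<lambda>\<pi>. mat_rank (square_unfolding (permute_tensor \<pi> F))"]
    by (simp add: setcompr_eq_image)
  have d: "deinterleave (length As) permutes {..<length (dims F)}"
    unfolding len by (rule deinterleave_permutes)
  have "mat_rank (square_unfolding (permute_tensor (deinterleave (length As)) F)) \<le> mplus_rank F"
    unfolding mplus_rank_def using d by (intro Max_ge[OF fin]) blast
  with mat_rank_deinterleaved_ge[OF assms] have p_le: "?p \<le> mplus_rank F" by linarith
  have le_r: "mplus_rank F \<le> r" if "cp_rank_at_most F r" for r
    unfolding mplus_rank_def
    using d cp_rank_at_most_permute_tensor[OF that] mat_rank_square_unfolding_le
    by (subst Max_le_iff[OF fin]) blast+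
  have cp: "cp_rank_at_most F ?p" by (rule cp_rank_at_most_mat_product[OF assms])
  show m: "mplus_rank F = ?p" using le_r[OF cp] p_le by simp
  show "cp_rank F = ?p"
    unfolding cp_rank_eq_Least using cp le_r m by (intro Least_equality) auto
qed

theorem mainTheorem4:
  fixes d :: nat and n :: "nat \<Rightarrow> nat" and A :: "nat \<Rightarrow> complex mat"
    and F :: "complex tensor" and r :: "nat \<Rightarrow> nat"
  assumes "d \<ge> 1"
    and "\<And>i. i \<in> {1..d} \<Longrightarrow> A i \<in> carrier_mat (n (2 * i - 1)) (n (2 * i))"
    and "F = tensor_outer_list (map (\<lambda>i. tensor_of_mat (A i)) [1..<d + 1])"
    and "\<And>i. i \<in> {1..d} \<Longrightarrow> r i = mat_rank (A i)"
  shows "cp_rank F = mplus_rank F \<and> mplus_rank F = (\<Prod>i = 1..d. r i)"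
proof -
  let ?As = "map A [1..<d + 1]"
  have F: "F = tensor_outer_list (map tensor_of_mat ?As)"
    using assms(3) by (simp add: comp_def)
  have "(\<Prod>m<length ?As. mat_rank (?As ! m)) = (\<Prod>m<d. mat_rank (A (Suc m)))"
    by (intro prod.cong) (auto simp del: upt_Suc)
  also have "\<dots> = (\<Prod>i = 1..d. mat_rank (A i))"
    by (simp add: prod.atLeast1_atMost_eq)
  also have "\<dots> = (\<Prod>i = 1..d. r i)"
    using assms(4) by (intro prod.cong) auto
  finally show ?thesis using ranks_of_mat_product[OF F] by simp
qed

end
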